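(* Let $A\in\mathbb{R}^{m\times n}$, $b\in\mathbb{R}^m$, $c\in\mathbb{R}^n$, let $\Omega=\{x\in\mathbb{R}^n \mid Ax=b,\ x\ge 0\}$, and assume that the linear program $\min\{c^Tx \mid x\in\Omega\}$ has at least one finite solution; let $X^*$ be its solution set and $x^*$ any element of $X^*$. Let $\mathcal{M}_*=\bigcup_{x^*\in X^*}(x^*+N_\Omega(x^* ))$, and let $\mathcal{M}_*^\infty$ be its asymptotic cone. For any $x^0\in\mathbb{R}^n$, assume that the sequence $\{x^\sigma\}$ is obtained by $$x^{\sigma+1}=P_\Omega(x^\sigma-\alpha^\sigma c),\qquad \sigma=0,1,2,\dots,$$ with step sizes $\alpha^\sigma>0$. Then: (i) There exists an $\bar\alpha$ such that if $\alpha^0\ge\bar\alpha$, then $x^1\in X^*$. (ii) There exists $0<\theta_{\min}\le\frac{\pi}{2}$ such that $$c^Tx^\sigma-c^Tx^{\sigma+1}\ \ge\ \alpha^\sigma(1-\cos\theta_{\min})\|c\|^2$$ if $x^{\sigma+1}\notin X^*$. Moreover, $\theta_{\min}=\arccos\left(\frac{\|P_{\mathrm{bd}(\mathcal{M}_*^\infty)}(-c)\|}{\|c\|}\right)$. (iii) For any $\alpha>0$ and $p\in\{-1\}\cup\mathbb{N}^+$, if $\alpha^\sigma\ge\alpha$ for all indices $\sigma=p,p+1,\dots$ (with $\sigma\ge 0$), then for $$\Gamma=\left[\frac{c^Tx^{p+1}-c^Tx^*}{\alpha(1-\cos\theta_{\min})\|c\|^2}+p+2\right]_+$$ (with $\theta_{\min}$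 as in (ii)) one has $x^\Gamma\in X^*$.
   Context: $\|\cdot\|$ is the Euclidean norm. $P_\Omega(y)=\arg\min_{x\in\Omega}\frac12\|x-y\|^2$ is the projection onto $\Omega$; the iteration $x^{\sigma+1}=P_\Omega(x^\sigma-\alpha^\sigma c)$ is equivalent to the proximal point iteration $x^{\sigma+1}=\arg\min_{x\in\Omega}\ c^Tx+\frac{1}{2\alpha^\sigma}\|x-x^\sigma\|^2$. $N_\Omega(x)=\{v \mid v^T(y-x)\le 0\ \ \forall y\in\Omega\}$ is the normal cone of $\Omega$ at $x\in\Omega$. The asymptotic cone of a nonempty set $C\subset\mathbb{R}^n$ is $C^\infty=\{d \mid \exists\, s_k\to+\infty,\ x_k\in C \text{ with } x_k/s_k\to d\}$. $\mathrm{bd}(S)$ denotes the boundary of $S$ and $P_{\mathrm{bd}(S)}(y)$ denotes the projection of $y$ onto $\mathrm{bd}(S)$ (a point of $\mathrm{bd}(S)$ nearest to $y$). $\mathbb{N}^+$ is the set of positive integers. For a real number $r$, $[r]_+$ here denotes the nonnegative integer $\max\{0,\lfloor r\rfloor\}$.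
   Formalization: The point x^0 is assumed to lie in Ω for (ii) at σ=0 and for (iii) at p=-1, since both fail for infeasible x^0; the formula for θ_min is claimed only when bd(M_*^∞) is nonempty, as otherwise the projection onto it does not exist. *)

theory Defs
  imports "HOL-Analysis.Analysis"
begin

definition feasible :: "real^'n^'m \<Rightarrow> real^'m \<Rightarrow> (real^'n) set" where
  "feasible A b = {x. A *v x = b \<and> (\<forall>i. 0 \<le> x $ i)}"

definition lp_solutions :: "real^'n^'m \<Rightarrow> real^'m \<Rightarrow> real^'n \<Rightarrow> (real^'n) set" where
  "lp_solutions A b c = {x \<in> feasible A b. \<forall>y \<in> feasible A b. c \<bullet> x \<le> c \<bullet> y}"

text \<open>Only meant for points \<open>x \<in> \<Omega>\<close>.\<close>
definition normal_cone :: "'a::real_inner set \<Rightarrow> 'a \<Rightarrow> 'a set" where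
  "normal_cone \<Omega> x = {v. \<forall>y\<in>\<Omega>. v \<bullet> (y - x) \<le> 0}"

definition asymptotic_cone :: "'a::real_normed_vector set \<Rightarrow> 'a set" where
  "asymptotic_cone C = {d. \<exists>(s :: nat \<Rightarrow> real) x. filterlim s at_top sequentially \<and>
     (\<forall>k. x k \<in> C) \<and> (\<lambda>k. x k /\<^sub>R s k) \<longlonglongrightarrow> d}"

definition solution_normals :: "real^'n^'m \<Rightarrow> real^'m \<Rightarrow> real^'n \<Rightarrow> (real^'n) set" where
  "solution_normals A b c =
     (\<Union>x \<in> lp_solutions A b c. (\<lambda>v. x + v) ` normal_cone (feasible A b) x)"

text \<open>The Euclidean projection onto a set is \<^const>\<open>closest_point\<close>. The starting point
  \<open>x 0\<close> is arbitrary; it need not be feasible.\<close>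
definition projection_iteration ::
    "real^'n^'m \<Rightarrow> real^'m \<Rightarrow> real^'n \<Rightarrow> (nat \<Rightarrow> real) \<Rightarrow> (nat \<Rightarrow> real^'n) \<Rightarrow> bool" where
  "projection_iteration A b c \<alpha> x \<longleftrightarrow>
     (\<forall>\<sigma>. 0 < \<alpha> \<sigma> \<and> x (Suc \<sigma>) = closest_point (feasible A b) (x \<sigma> - \<alpha> \<sigma> *\<^sub>R c))"

end

theory Submission
  imports Defs
begin

text \<open>
  The polyhedron \<open>\<Omega>\<close> has only finitely many normal cones, all of them closed, and \<open>x \<in> \<Omega>\<close> is
  optimal iff \<open>-c\<close> lies in the normal cone at \<open>x\<close>. Hence a ball around \<open>-c\<close> misses every normal
  cone at a non-optimal point. As the projection is nonexpansive and maps \<open>q - t c\<close> to \<open>q\<close> for optimal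
  \<open>q\<close>, this gives both finite termination in one large step and \<open>-c \<in> interior M\<close>, where \<open>M\<close> is the
  asymptotic cone of \<open>\<M>\<^sub>*\<close>. In the other direction, a normal vector \<open>v\<close> at a non-optimal
  point never lies in the interior of \<open>M\<close>: otherwise \<open>v + \<epsilon> c \<in> M\<close> would, by finiteness, be normal
  at some optimal point, against the monotonicity of normal cones. A step that ends at a non-optimal point leaves the residual
  \<open>v = x - \<alpha> c - z\<close> normal at \<open>z\<close>, so \<open>v\<close> makes an angle of at least \<open>\<theta>\<^sub>m\<^sub>i\<^sub>n\<close> with \<open>-c\<close>;
  together with \<open>\<parallel>v\<parallel>\<^sup>2 \<le> -\<alpha> c \<bullet> v\<close> this bounds the decrease of the objective from below.
\<close>

section \<open>Normal cones and projections\<close>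

lemma closed_normal_cone: "closed (normal_cone S x)"
proof -
  have "normal_cone S x = (\<Inter>y\<in>S. {v. (y - x) \<bullet> v \<le> 0})"
    by (auto simp: normal_cone_def inner_commute)
  then show ?thesis
    by (auto intro!: closed_INT closed_halfspace_le)
qed

lemma normal_cone_scaleR: "v \<in> normal_cone S x \<Longrightarrow> 0 \<le> t \<Longrightarrow> t *\<^sub>R v \<in> normal_cone S x"
  by (simp add: normal_cone_def mult_nonneg_nonpos)

lemma normal_cone_monotone:
  assumes "v \<in> normal_cone S x" "w \<in> normal_cone S y" "x \<in> S" "y \<in> S"
  shows "0 \<le> (v - w) \<bullet> (x - y)"
proof -
  have "v \<bullet> (y - x) \<le> 0" "w \<bullet> (x - y) \<le> 0"
    using assms by (auto simp: normal_cone_def)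
  then show ?thesis
    by (simp add: algebra_simps)
qed

text \<open>In the expansion of the squared distance from x + v to y, the cross term -2 v . (y - x)
  is nonnegative.\<close>

lemma closest_point_add_normal:
  fixes x v :: "'a::euclidean_space"
  assumes "convex S" "closed S" "x \<in> S" "v \<in> normal_cone S x"
  shows "closest_point S (x + v) = x"
proof -
  have "dist (x + v) x \<le> dist (x + v) y" if "y \<in> S" for y
  proof -
    have "v \<bullet> (y - x) \<le> 0"
      using assms that by (simp add: normal_cone_def)
    moreover have "(norm (x + v - y))\<^sup>2 = (norm v)\<^sup>2 - 2 * (v \<bullet> (y - x)) + (norm (y - x))\<^sup>2"
      by (simp add: power2_norm_eq_inner algebra_simps inner_commute)
    ultimately have "(norm v)\<^sup>2 \<le> (norm (x + v - y))\<^sup>2"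
      by (smt (verit) zero_le_power2)
    then show ?thesis
      by (simp add: dist_norm)
  qed
  then show ?thesis
    using closest_point_unique[OF assms(1-3)] by metis
qed

lemma closest_point_residual_normal:
  fixes y :: "'a::euclidean_space"
  assumes "convex S" "closed S"
  shows "y - closest_point S y \<in> normal_cone S (closest_point S y)"
  using closest_point_dot[OF assms] by (auto simp: normal_cone_def)

section \<open>Positive homogeneity of asymptotic cones\<close>

lemma asymptotic_cone_scaleR:
  assumes "d \<in> asymptotic_cone C" "0 < t"
  shows "t *\<^sub>R d \<in> asymptotic_cone C"
proof -
  obtain s :: "nat \<Rightarrow> real" and x where s: "filterlim s at_top sequentially" and x: "\<And>k. x k \<in> C"
    and lim: "(\<lambda>k. x k /\<^sub>R s k) \<longlonglongrightarrow> d"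
    using assms(1) unfolding asymptotic_cone_def by blast
  have "filterlim (\<lambda>k. inverse t * s k) at_top sequentially"
    using assms(2) s by (intro filterlim_tendsto_pos_mult_at_top[OF tendsto_const]) auto
  moreover have "(\<lambda>k. x k /\<^sub>R (inverse t * s k)) \<longlonglongrightarrow> t *\<^sub>R d"
    using tendsto_scaleR[OF tendsto_const lim, of t] by (simp add: inverse_mult_distrib)
  ultimately show ?thesis
    unfolding asymptotic_cone_def using x by blast
qed

text \<open>Stated as a set equation so that scaling can be moved through \<open>interior\<close>
  and \<open>closure\<close>.\<close>

lemma asymptotic_cone_scaleR_image:
  assumes "0 < t"
  shows "(*\<^sub>R) t ` asymptotic_cone C = asymptotic_cone C"
proof
  show "(*\<^sub>R) t ` asymptotic_cone C \<subseteq> asymptotic_cone C"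
    using asymptotic_cone_scaleR assms by blast
  show "asymptotic_cone C \<subseteq> (*\<^sub>R) t ` asymptotic_cone C"
  proof
    fix d assume "d \<in> asymptotic_cone C"
    then have "inverse t *\<^sub>R d \<in> asymptotic_cone C" "d = t *\<^sub>R inverse t *\<^sub>R d"
      using assms asymptotic_cone_scaleR[of d C "inverse t"] by auto
    then show "d \<in> (*\<^sub>R) t ` asymptotic_cone C"
      by blast
  qed
qed

section \<open>The angle between a vector and the boundary of a cone\<close>

text \<open>The ball is connected, so if it left D it would meet the frontier at a point closer to e
  than r.\<close>

lemma ball_subset_interior_of_frontier:
  fixes e :: "'a::euclidean_space"
  assumes "e \<in> interior D" "\<And>x. x \<in> frontier D \<Longrightarrow> r \<le> dist e x"
  shows "ball e r \<subseteq> interior D"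
proof (cases "0 < r")
  case True
  have "ball e r \<subseteq> D"
  proof (rule ccontr)
    assume "\<not> ball e r \<subseteq> D"
    then have "ball e r - D \<noteq> {}" by blast
    moreover have "e \<in> ball e r \<inter> D"
      using True assms(1) interior_subset by auto
    then have "ball e r \<inter> D \<noteq> {}" by blast
    ultimately have "ball e r \<inter> frontier D \<noteq> {}"
      by (intro connected_Int_frontier connected_ball)
    then show False
      using assms(2) by fastforce
  qed
  then show ?thesis
    by (simp add: interior_maximal)
qed (simp add: ball_empty)

lemma scaleR_in_interior_cone:
  fixes D :: "'a::euclidean_space set"
  assumes "\<And>t. 0 < t \<Longrightarrow> (*\<^sub>R) t ` D = D" "v \<in> interior D" "0 < t"
  shows "t *\<^sub>R v \<in> interior D"
proof -
  have "inj ((*\<^sub>R) t :: 'a \<Rightarrow> 'a)"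
    using assms(3) by (intro injI) simp
  then have "interior D = (*\<^sub>R) t ` interior D"
    using interior_injective_linear_image[of "(*\<^sub>R) t" D] assms(1,3) linear_scaleR by metis
  then show ?thesis
    using assms(2) by blast
qed

lemma scaleR_in_frontier_cone:
  fixes D :: "'a::euclidean_space set"
  assumes "\<And>t. 0 < t \<Longrightarrow> (*\<^sub>R) t ` D = D" "v \<in> frontier D" "0 < t"
  shows "t *\<^sub>R v \<in> frontier D"
proof -
  have "(*\<^sub>R) t ` closure D = closure D"
    using assms closure_scaleR[of t D] by metis
  then have "t *\<^sub>R v \<in> closure D"
    using assms(2) by (auto simp: frontier_def)
  moreover have "t *\<^sub>R v \<notin> interior D"
    using scaleR_in_interior_cone[OF assms(1), of "t *\<^sub>R v" "inverse t"] assms(2,3)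
    by (auto simp: frontier_def)
  ultimately show ?thesis
    by (simp add: frontier_def)
qed

text \<open>As p minimises the distance to e along its own ray, e - p is orthogonal to p. Testing
  two values of t replaces differentiation.\<close>

lemma nearest_on_cone_orthogonal:
  fixes e p :: "'a::real_inner"
  assumes "\<And>t. 0 < t \<Longrightarrow> norm (e - p) \<le> norm (e - t *\<^sub>R p)"
  shows "e \<bullet> p = (norm p)\<^sup>2"
proof (cases "p = 0")
  case False
  define g where "g = e \<bullet> p"
  define P where "P = (norm p)\<^sup>2"
  have P: "P > 0" using False by (simp add: P_def)
  have *: "2 * (t - 1) * g \<le> (t\<^sup>2 - 1) * P" if "0 < t" for t
  proof -
    have "(norm (e - p))\<^sup>2 \<le> (norm (e - t *\<^sub>R p))\<^sup>2"
      using assms[OF that] by (simp add: power_mono)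
    then show ?thesis
      unfolding g_def P_def power2_norm_eq_inner
      by (simp add: algebra_simps inner_commute power2_eq_square)
  qed
  \<comment> \<open>The test value 1/2 gives g \<ge> 3/4 P. Positivity of g makes t = g / P
    admissible as the second test value, and that one forces t = 1.\<close>
  have pos: "0 < g"
  proof -
    have "2 * (1/2 - 1) * g \<le> ((1/2)\<^sup>2 - 1) * P"
      by (rule *) simp
    then show ?thesis using P by (simp add: power2_eq_square)
  qed
  define t where "t = g / P"
  have t: "0 < t" "g = t * P" using pos P by (simp_all add: t_def)
  then have "(2 * (t - 1) * t) * P \<le> (t\<^sup>2 - 1) * P"
    using *[of t] by (simp add: mult.assoc)
  then have "2 * (t - 1) * t \<le> t\<^sup>2 - 1"
    using P by (rule mult_right_le_imp_le)
  then have "(t - 1)\<^sup>2 \<le> 0"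
    by (simp add: power2_eq_square algebra_simps)
  then show ?thesis
    using t(2) by (simp add: g_def P_def)
qed simp

text \<open>The ball around e that reaches to p stays inside the interior, so the ray through v
  misses it. Hence v makes at least the same angle with e as p does, and by orthogonality the cosine
  of the latter is norm p / norm e.\<close>

lemma inner_le_of_notin_interior_cone:
  fixes D :: "'a::euclidean_space set"
  assumes cone: "\<And>t. 0 < t \<Longrightarrow> (*\<^sub>R) t ` D = D"
    and e: "e \<in> interior D"
    and p: "p \<in> frontier D" "\<And>x. x \<in> frontier D \<Longrightarrow> dist e p \<le> dist e x"
    and v: "v \<notin> interior D"
  shows "norm p < norm e" "v \<bullet> e \<le> norm v * norm p"
proof -
  have "e \<bullet> p = (norm p)\<^sup>2"
    using p scaleR_in_frontier_cone[OF cone p(1)]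
    by (intro nearest_on_cone_orthogonal) (simp add: dist_norm)
  then have dist2: "(norm (e - p))\<^sup>2 = (norm e)\<^sup>2 - (norm p)\<^sup>2"
    by (simp add: power2_norm_eq_inner algebra_simps inner_commute)
  have "e \<noteq> p"
    using e p(1) by (auto simp: frontier_def)
  then have "0 < (norm (e - p))\<^sup>2" by simp
  then show "norm p < norm e"
    using dist2 by (simp add: power_less_imp_less_base)
  show "v \<bullet> e \<le> norm v * norm p"
  proof (cases "v \<bullet> e \<le> 0")
    case True
    then show ?thesis by (smt (verit) mult_nonneg_nonneg norm_ge_zero)
  next
    case False
    define g where "g = v \<bullet> e"
    define V where "V = (norm v)\<^sup>2"
    \<comment> \<open>With this t, \<open>t *\<^sub>R v\<close> is the foot of the perpendicular
      from e, the point where the ray of v comes closest to e.\<close>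
    define t where "t = g / V"
    have g: "0 < g" and V: "0 < V" and t: "0 < t"
      using False by (auto simp: g_def V_def t_def intro!: divide_pos_pos)
    have "t *\<^sub>R v \<notin> interior D"
      using scaleR_in_interior_cone[OF cone, of "t *\<^sub>R v" "inverse t"] v t by auto
    then have "t *\<^sub>R v \<notin> ball e (dist e p)"
      using ball_subset_interior_of_frontier[OF e p(2)] by blast
    then have "(norm (e - p))\<^sup>2 \<le> (norm (e - t *\<^sub>R v))\<^sup>2"
      by (simp add: dist_norm power_mono)
    also have "(norm (e - t *\<^sub>R v))\<^sup>2 = (norm e)\<^sup>2 - 2 * t * g + t\<^sup>2 * V"
      unfolding power2_norm_eq_inner g_def V_def
      by (simp add: algebra_simps inner_commute power2_eq_square)
    also have "\<dots> = (norm e)\<^sup>2 - g\<^sup>2 / V"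
      using V by (simp add: t_def field_simps power2_eq_square)
    finally have "g\<^sup>2 / V \<le> (norm p)\<^sup>2"
      using dist2 by simp
    then have "g\<^sup>2 \<le> (norm v * norm p)\<^sup>2"
      using V by (simp add: field_simps V_def power_mult_distrib)
    then show ?thesis
      unfolding g_def by (rule power2_le_imp_le) simp
  qed
qed

section \<open>The feasible polyhedron\<close>

lemma convex_feasible: "convex (feasible A b)"
  unfolding convex_def feasible_def
  by (auto simp: matrix_vector_right_distrib matrix_vector_mult_scaleR
      simp flip: scaleR_left_distrib)

lemma closed_feasible: "closed (feasible A b)"
proof -
  have "feasible A b = {x. A *v x = b} \<inter> (\<Inter>i. {x. 0 \<le> x $ i})"
    by (auto simp: feasible_def)
  moreover have "closed {x. A *v x = b}"
    by (intro closed_Collect_eq continuous_intros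
        linear_continuous_on[OF matrix_vector_mul_bounded_linear])
  moreover have "closed {x::real^'a. 0 \<le> x $ i}" for i
    by (intro closed_Collect_le continuous_intros)
  ultimately show ?thesis by (simp add: closed_Int closed_INT)
qed

text \<open>Coordinate i becomes (1 + t) x_i - t y_i, which stays nonnegative once t y_i \<le> x_i.
  Coordinates where x vanishes impose nothing, because y vanishes there too.\<close>

lemma feasible_extrapolate:
  fixes x y :: "real^'n"
  assumes x: "x \<in> feasible A b" and y: "y \<in> feasible A b" and zero: "\<And>i. x $ i = 0 \<Longrightarrow> y $ i = 0"
  obtains t where "0 < t" "x - t *\<^sub>R (y - x) \<in> feasible A b"
proof -
  have "\<exists>t>0. t * y $ i \<le> x $ i" for i
  proof (cases "x $ i = 0")
    case True
    then show ?thesis using zero by (intro exI[of _ 1]) auto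
  next
    case False
    then have xi: "0 < x $ i" "0 \<le> y $ i" using x y by (auto simp: feasible_def less_le)
    \<comment> \<open>Adding 1 to the denominator covers y_i = 0 without a further case.\<close>
    then have "x $ i / (1 + y $ i) * y $ i \<le> x $ i"
      by (simp add: field_simps)
    then show ?thesis using xi by (intro exI[of _ "x $ i / (1 + y $ i)"]) auto
  qed
  then obtain u where u: "\<And>i. 0 < u i" "\<And>i. u i * y $ i \<le> x $ i" by metis
  define t where "t = Min (range u)"
  have t: "0 < t" using u(1) by (simp add: t_def)
  have "t \<le> u i" for i by (simp add: t_def)
  then have "t * y $ i \<le> x $ i" for i
    using u(2)[of i] y mult_right_mono[of t "u i" "y $ i"] by (fastforce simp: feasible_def)
  then have "0 \<le> (x - t *\<^sub>R (y - x)) $ i" for i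
    using x t by (auto simp: feasible_def algebra_simps intro: add_nonneg_nonneg)
       (smt (verit) mult_nonneg_nonneg)
  moreover have "A *v (x - t *\<^sub>R (y - x)) = b"
    using x y by (simp add: feasible_def matrix_vector_mult_diff_distrib matrix_vector_mult_scaleR)
  ultimately show ?thesis
    using that[OF t] by (simp add: feasible_def)
qed

text \<open>The segment from y to x can be prolonged beyond x inside the polyhedron, so a linear
  functional v that is maximal at x is constant along it and hence maximal at y. Geometrically, y
  lies in the smallest face containing x.\<close>

lemma normal_cone_antimono_support:
  assumes x: "x \<in> feasible A b" and y: "y \<in> feasible A b" and zero: "\<And>i. x $ i = 0 \<Longrightarrow> y $ i = 0"
  shows "normal_cone (feasible A b) x \<subseteq> normal_cone (feasible A b) y"
proof
  fix v assume v: "v \<in> normal_cone (feasible A b) x"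
  obtain t where t: "0 < t" "x - t *\<^sub>R (y - x) \<in> feasible A b"
    using feasible_extrapolate[OF assms] by blast
  then have "v \<bullet> (x - t *\<^sub>R (y - x) - x) \<le> 0"
    using v unfolding normal_cone_def by blast
  then have "0 \<le> v \<bullet> (y - x)"
    using t(1) by (simp add: zero_le_mult_iff)
  moreover have "v \<bullet> (w - y) = v \<bullet> (w - x) - v \<bullet> (y - x)" for w
    by (simp add: algebra_simps)
  ultimately show "v \<in> normal_cone (feasible A b) y"
    using v by (fastforce simp: normal_cone_def)
qed

text \<open>Points with the same zero coordinates have equal normal cones, by the preceding
  inclusion in both directions, and there are finitely many zero sets. \<open>r\<close> picks one
  point per zero set.\<close>

lemma finite_normal_cones: "finite (normal_cone (feasible A b) ` feasible A b)"
proof -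
  define Z where "Z x = {i. x $ i = 0}" for x :: "real^'a"
  define r where "r S = (SOME x. x \<in> feasible A b \<and> Z x = S)" for S
  have "normal_cone (feasible A b) x = normal_cone (feasible A b) (r (Z x))"
    if x: "x \<in> feasible A b" for x
  proof -
    have "r (Z x) \<in> feasible A b \<and> Z (r (Z x)) = Z x"
      unfolding r_def by (rule someI) (use x in simp)
    then show ?thesis
      using x by (intro equalityI normal_cone_antimono_support) (auto simp: Z_def)
  qed
  then have "normal_cone (feasible A b) ` feasible A b \<subseteq> (\<lambda>S. normal_cone (feasible A b) (r S)) ` UNIV"
    by blast
  then show ?thesis
    by (rule finite_subset) simp
qed

text \<open>S may be infinite, but only finitely many different cones occur in the union.\<close>

lemma closed_Union_normal_cones:
  assumes "S \<subseteq> feasible A b"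
  shows "closed (\<Union>x\<in>S. normal_cone (feasible A b) x)"
proof -
  have "finite (normal_cone (feasible A b) ` S)"
    using assms by (intro finite_subset[OF _ finite_normal_cones]) blast
  then show ?thesis
    by (intro closed_Union) (auto simp: closed_normal_cone)
qed

section \<open>Solutions and their normals\<close>

lemma lp_solutions_iff_normal:
  "x \<in> lp_solutions A b c \<longleftrightarrow> x \<in> feasible A b \<and> - c \<in> normal_cone (feasible A b) x"
  by (auto simp: lp_solutions_def normal_cone_def inner_diff_right)

lemma solution_normals_iff:
  "y \<in> solution_normals A b c \<longleftrightarrow>
    (\<exists>q \<in> lp_solutions A b c. y - q \<in> normal_cone (feasible A b) q)"
proof -
  have "y \<in> (+) q ` N \<longleftrightarrow> y - q \<in> N" for q :: "real^'a" and N
    by (auto intro: image_eqI[of _ _ "y - q"])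
  then show ?thesis
    by (simp add: solution_normals_def)
qed

text \<open>Dividing by t turns closeness of y to q - t c into closeness of a rescaled residual to
  -c. This is why the tolerance grows linearly in t and why one \<delta> serves all q, y and
  t.\<close>

lemma projection_in_lp_solutions:
  assumes "lp_solutions A b c \<noteq> {}"
  obtains \<delta> where "0 < \<delta>"
    "\<And>q y t. q \<in> lp_solutions A b c \<Longrightarrow> 0 < t \<Longrightarrow> norm (y - q + t *\<^sub>R c) < \<delta> * t \<Longrightarrow>
       closest_point (feasible A b) y \<in> lp_solutions A b c"
proof -
  let ?\<Omega> = "feasible A b" and ?X = "lp_solutions A b c"
  have ne: "?\<Omega> \<noteq> {}" using assms by (auto simp: lp_solutions_def)
  define U where "U = (\<Union>x\<in>?\<Omega> - ?X. normal_cone ?\<Omega> x)"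
  have "closed U" unfolding U_def by (intro closed_Union_normal_cones) auto
  moreover have "- c \<in> - U" by (auto simp: U_def lp_solutions_iff_normal)
  ultimately obtain r where r: "0 < r" "ball (- c) r \<subseteq> - U"
    by (metis open_Compl open_contains_ball)
  \<comment> \<open>The error enters twice, through y itself and through the distance of its
    projection from q; hence half the radius.\<close>
  have "closest_point ?\<Omega> y \<in> ?X"
    if q: "q \<in> ?X" and t: "0 < t" and near: "norm (y - q + t *\<^sub>R c) < r / 2 * t" for q y t
  proof (rule ccontr)
    define z where "z = closest_point ?\<Omega> y"
    assume "closest_point ?\<Omega> y \<notin> ?X"
    moreover have "z \<in> ?\<Omega>"
      unfolding z_def by (rule closest_point_in_set[OF closed_feasible ne])
    moreover have "inverse t *\<^sub>R (y - z) \<in> normal_cone ?\<Omega> z"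
      unfolding z_def using t
      by (intro normal_cone_scaleR closest_point_residual_normal convex_feasible closed_feasible) auto
    ultimately have inU: "inverse t *\<^sub>R (y - z) \<in> U"
      unfolding U_def z_def by blast
    have "t *\<^sub>R (- c) \<in> normal_cone ?\<Omega> q"
      using q t by (intro normal_cone_scaleR) (auto simp: lp_solutions_iff_normal)
    then have "closest_point ?\<Omega> (q + t *\<^sub>R (- c)) = q"
      using q by (intro closest_point_add_normal convex_feasible closed_feasible)
        (auto simp: lp_solutions_iff_normal)
    then have "norm (z - q) \<le> norm (y - q + t *\<^sub>R c)"
      using closest_point_lipschitz[OF convex_feasible closed_feasible ne, of y "q + t *\<^sub>R (- c)"]
      by (simp add: z_def dist_norm algebra_simps)
    moreover have "norm (y - z + t *\<^sub>R c) \<le> norm (y - q + t *\<^sub>R c) + norm (z - q)"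
      using norm_triangle_ineq4[of "y - q + t *\<^sub>R c" "z - q"] by (simp add: algebra_simps)
    ultimately have "norm (y - z + t *\<^sub>R c) < r * t"
      using near by simp
    moreover have "norm (y - z + t *\<^sub>R c) = t * norm (inverse t *\<^sub>R (y - z) + c)"
    proof -
      have "y - z + t *\<^sub>R c = t *\<^sub>R (inverse t *\<^sub>R (y - z) + c)"
        using t by (simp add: scaleR_add_right)
      then show ?thesis using t by (metis abs_of_pos norm_scaleR)
    qed
    ultimately have "norm (inverse t *\<^sub>R (y - z) + c) < r"
      using t by (simp add: mult.commute)
    then have "inverse t *\<^sub>R (y - z) \<in> ball (- c) r"
      by (simp add: dist_norm norm_minus_commute algebra_simps)
    with r(2) inU show False by blast
  qed
  then show ?thesis
    using that[of "r / 2"] r(1) by auto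
qed

text \<open>For d near -c the whole ray from q in direction d projects into the solution set, so it
  lies in \<open>solution_normals\<close>. Its points, divided by the ray parameter, tend to
  d.\<close>

lemma uminus_cost_in_interior:
  assumes "lp_solutions A b c \<noteq> {}"
  shows "- c \<in> interior (asymptotic_cone (solution_normals A b c))"
proof -
  let ?\<Omega> = "feasible A b" and ?X = "lp_solutions A b c"
  obtain \<delta> where \<delta>: "0 < \<delta>"
    "\<And>q y t. q \<in> ?X \<Longrightarrow> 0 < t \<Longrightarrow> norm (y - q + t *\<^sub>R c) < \<delta> * t \<Longrightarrow> closest_point ?\<Omega> y \<in> ?X"
    using projection_in_lp_solutions[OF assms] by metis
  obtain q where q: "q \<in> ?X" using assms by blast
  have "ball (- c) \<delta> \<subseteq> asymptotic_cone (solution_normals A b c)"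
  proof
    fix d assume "d \<in> ball (- c) \<delta>"
    then have d: "norm (d + c) < \<delta>"
      by (metis add.commute diff_minus_eq_add dist_commute dist_norm mem_ball)
    have "q + t *\<^sub>R d \<in> solution_normals A b c" if "0 < t" for t
    proof -
      have "q + t *\<^sub>R d - q + t *\<^sub>R c = t *\<^sub>R (d + c)" by (simp add: algebra_simps)
      then have "norm (q + t *\<^sub>R d - q + t *\<^sub>R c) < \<delta> * t"
        using that d by (simp only: norm_scaleR) (simp add: mult.commute)
      then have "closest_point ?\<Omega> (q + t *\<^sub>R d) \<in> ?X"
        by (rule \<delta>(2)[OF q that])
      moreover have "q + t *\<^sub>R d - closest_point ?\<Omega> (q + t *\<^sub>R d)
          \<in> normal_cone ?\<Omega> (closest_point ?\<Omega> (q + t *\<^sub>R d))"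
        by (rule closest_point_residual_normal[OF convex_feasible closed_feasible])
      ultimately show ?thesis
        unfolding solution_normals_iff by blast
    qed
    then have "\<forall>k. q + real (Suc k) *\<^sub>R d \<in> solution_normals A b c" by simp
    moreover have s: "filterlim (\<lambda>k. real (Suc k)) at_top sequentially"
      by (rule filterlim_compose[OF filterlim_real_sequentially filterlim_Suc])
    moreover have "(\<lambda>k. (q + real (Suc k) *\<^sub>R d) /\<^sub>R real (Suc k)) \<longlonglongrightarrow> d"
    proof -
      have "(\<lambda>k. inverse (real (Suc k)) *\<^sub>R q + d) \<longlonglongrightarrow> 0 *\<^sub>R q + d"
        by (intro tendsto_intros tendsto_inverse_0_at_top s)
      then show ?thesis by (simp add: scaleR_add_right del: of_nat_Suc)
    qed
    ultimately show "d \<in> asymptotic_cone (solution_normals A b c)"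
      unfolding asymptotic_cone_def mem_Collect_eq
      by (intro exI[of _ "\<lambda>k. real (Suc k)"] exI[of _ "\<lambda>k. q + real (Suc k) *\<^sub>R d"] conjI)
  qed
  then show ?thesis
    using \<delta>(1) by (meson centre_in_ball interior_maximal open_ball subsetD)
qed

text \<open>If v were interior, a small shift d = v + \<epsilon> c would still lie in the asymptotic
  cone. The base points q k of an approximating sequence may be unbounded, so q k - z is first shown
  to be o(s k). Closedness then makes d normal at some optimal w, and monotonicity between w and z
  gives c . (w - z) \<ge> 0, so z is optimal.\<close>

lemma normal_at_nonsolution_notin_interior:
  assumes z: "z \<in> feasible A b" "z \<notin> lp_solutions A b c" and v: "v \<in> normal_cone (feasible A b) z"
  shows "v \<notin> interior (asymptotic_cone (solution_normals A b c))"
proof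
  let ?\<Omega> = "feasible A b" and ?X = "lp_solutions A b c"
  assume "v \<in> interior (asymptotic_cone (solution_normals A b c))"
  then obtain r where r: "0 < r" "ball v r \<subseteq> asymptotic_cone (solution_normals A b c)"
    by (meson mem_interior)
  \<comment> \<open>The summand 1 keeps the denominator positive for c = 0; the factor 2 makes the
    shift strictly shorter than r.\<close>
  define \<epsilon> where "\<epsilon> = r / (2 * (norm c + 1))"
  have \<epsilon>: "0 < \<epsilon>" using r(1) by (simp add: \<epsilon>_def add_nonneg_pos)
  have "\<epsilon> * norm c < r"
  proof -
    have "\<epsilon> * norm c \<le> \<epsilon> * (norm c + 1)" using \<epsilon> by simp
    also have "\<dots> = r / 2" by (simp add: \<epsilon>_def add_nonneg_eq_0_iff field_simps)
    finally show ?thesis using r(1) by simp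
  qed
  define d where "d = v + \<epsilon> *\<^sub>R c"
  have "d \<in> ball v r" using \<open>\<epsilon> * norm c < r\<close> \<epsilon> by (simp add: d_def dist_norm)
  then obtain s :: "nat \<Rightarrow> real" and y where s: "filterlim s at_top sequentially"
    and y: "\<And>k. y k \<in> solution_normals A b c" and lim: "(\<lambda>k. y k /\<^sub>R s k) \<longlonglongrightarrow> d"
    using r(2) unfolding asymptotic_cone_def by blast
  have "\<forall>k. \<exists>q. q \<in> ?X \<and> y k - q \<in> normal_cone ?\<Omega> q"
    using y unfolding solution_normals_iff by blast
  then obtain q where q: "\<And>k. q k \<in> ?X" and n: "\<And>k. y k - q k \<in> normal_cone ?\<Omega> (q k)"
    by metis
  have q\<Omega>: "q k \<in> ?\<Omega>" for k using q by (simp add: lp_solutions_def)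
  have cost: "c \<bullet> (q k - z) \<le> 0" for k
    using q[of k] z(1) by (simp add: lp_solutions_def inner_diff_right)
  \<comment> \<open>The error of approximating y k by s k d + z, in units of s k. Including z makes
    q k - z appear in the monotonicity estimate.\<close>
  define \<eta> where "\<eta> k = y k /\<^sub>R s k - d - z /\<^sub>R s k" for k
  have inv: "(\<lambda>k. inverse (s k)) \<longlonglongrightarrow> 0"
    by (rule tendsto_inverse_0_at_top[OF s])
  have \<eta>: "\<eta> \<longlonglongrightarrow> 0"
  proof -
    have "\<eta> \<longlonglongrightarrow> d - d - 0 *\<^sub>R z"
      unfolding \<eta>_def by (intro tendsto_intros lim inv)
    then show ?thesis by simp
  qed
  have s0: "\<forall>\<^sub>F k in sequentially. 0 < s k"
    using s by (simp add: filterlim_at_top_dense)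
  \<comment> \<open>The normal y k - q k at q k is compared with s k v at z. The cost term has a
    favourable sign because q k is optimal, which leaves |q k - z|^2 \<le> s k (\<eta> k . (q k -
    z)).\<close>
  have bound: "norm ((q k - z) /\<^sub>R s k) \<le> norm (\<eta> k)" if sk: "0 < s k" for k
  proof (cases "q k = z")
    case False
    have "s k *\<^sub>R v \<in> normal_cone ?\<Omega> z"
      using v sk by (intro normal_cone_scaleR) auto
    then have "0 \<le> (y k - q k - s k *\<^sub>R v) \<bullet> (q k - z)"
      by (rule normal_cone_monotone[OF n _ q\<Omega> z(1)])
    also have "y k - q k - s k *\<^sub>R v = s k *\<^sub>R \<eta> k + (s k * \<epsilon>) *\<^sub>R c - (q k - z)"
      using sk by (simp add: \<eta>_def d_def algebra_simps)
    also have "\<dots> \<bullet> (q k - z)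
        = s k * (\<eta> k \<bullet> (q k - z)) + s k * \<epsilon> * (c \<bullet> (q k - z)) - (norm (q k - z))\<^sup>2"
      unfolding power2_norm_eq_inner inner_diff_left[of _ "q k - z"] inner_add_left inner_scaleR_left ..
    finally have "(norm (q k - z))\<^sup>2 \<le> s k * (\<eta> k \<bullet> (q k - z)) + s k * \<epsilon> * (c \<bullet> (q k - z))"
      by simp
    also have "\<dots> \<le> s k * (\<eta> k \<bullet> (q k - z))"
      using cost[of k] sk \<epsilon> by (simp add: mult_nonneg_nonpos)
    also have "\<dots> \<le> s k * (norm (\<eta> k) * norm (q k - z))"
      using sk by (intro mult_left_mono norm_cauchy_schwarz) auto
    finally have "norm (q k - z) \<le> s k * norm (\<eta> k)"
      using False by (simp add: power2_eq_square)
    then have "inverse (s k) * norm (q k - z) \<le> norm (\<eta> k)"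
      using sk by (simp add: field_simps)
    then show ?thesis
      using sk by simp
  qed simp
  have "(\<lambda>k. (q k - z) /\<^sub>R s k) \<longlonglongrightarrow> 0"
    by (rule Lim_null_comparison[OF eventually_mono[OF s0 bound] tendsto_norm_zero[OF \<eta>]])
  from tendsto_diff[OF tendsto_diff[OF lim this] tendsto_scaleR[OF inv tendsto_const, of z]]
  have conv: "(\<lambda>k. (y k - q k) /\<^sub>R s k) \<longlonglongrightarrow> d"
    by (simp add: scaleR_diff_right)
  have "d \<in> (\<Union>x\<in>?X. normal_cone ?\<Omega> x)"
  proof (rule Lim_in_closed_set[OF _ _ _ conv])
    show "closed (\<Union>x\<in>?X. normal_cone ?\<Omega> x)"
      by (rule closed_Union_normal_cones) (auto simp: lp_solutions_def)
    show "\<forall>\<^sub>F k in sequentially. (y k - q k) /\<^sub>R s k \<in> (\<Union>x\<in>?X. normal_cone ?\<Omega> x)"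
      using s0
    proof eventually_elim
      case (elim k)
      then have "(y k - q k) /\<^sub>R s k \<in> normal_cone ?\<Omega> (q k)"
        using n by (intro normal_cone_scaleR) auto
      then show ?case using q by blast
    qed
  qed auto
  then obtain w where w: "w \<in> ?X" "d \<in> normal_cone ?\<Omega> w" by blast
  then have w\<Omega>: "w \<in> ?\<Omega>" by (simp add: lp_solutions_def)
  have "0 \<le> (d - v) \<bullet> (w - z)"
    by (rule normal_cone_monotone[OF w(2) v w\<Omega> z(1)])
  then have "0 \<le> c \<bullet> (w - z)"
    using \<epsilon> by (simp add: d_def zero_le_mult_iff)
  then have "z \<in> ?X"
    using w(1) z(1) by (force simp: lp_solutions_def inner_diff_right)
  with z(2) show False ..
qed

section \<open>Objective decrease and finite termination\<close>

text \<open>Here \<kappa> is the cosine of the angle bound. The decrease equals \<alpha> |c|^2 - g,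
  so g must be bounded from above; this comes from eliminating |v| between the angle bound and |v|^2
  \<le> \<alpha> g.\<close>

lemma projection_step_decrease:
  fixes c :: "real^'n"
  assumes x: "x \<in> feasible A b" and z: "z = closest_point (feasible A b) (x - \<alpha> *\<^sub>R c)"
    and "z \<notin> lp_solutions A b c" and \<alpha>: "0 < \<alpha>" and c: "c \<noteq> 0"
    and \<kappa>: "0 \<le> \<kappa>" "\<kappa> \<le> 1"
    and angle: "\<And>v. v \<notin> interior (asymptotic_cone (solution_normals A b c)) \<Longrightarrow>
      v \<bullet> (- c) \<le> norm v * (\<kappa> * norm c)"
  shows "\<alpha> * (1 - \<kappa>) * (norm c)\<^sup>2 \<le> c \<bullet> x - c \<bullet> z"
proof -
  define v where "v = x - \<alpha> *\<^sub>R c - z"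
  define g where "g = v \<bullet> (- c)"
  have v: "v \<in> normal_cone (feasible A b) z"
    unfolding v_def z by (rule closest_point_residual_normal[OF convex_feasible closed_feasible])
  have "z \<in> feasible A b"
    unfolding z using x by (intro closest_point_in_set closed_feasible) auto
  then have "g \<le> norm v * (\<kappa> * norm c)"
    unfolding g_def using assms(3) v by (intro angle normal_at_nonsolution_notin_interior)
  moreover have "(norm v)\<^sup>2 \<le> \<alpha> * g"
  proof -
    have "v \<bullet> (x - z) \<le> 0" using v x by (simp add: normal_cone_def)
    moreover have "x - z = v + \<alpha> *\<^sub>R c" by (simp add: v_def)
    ultimately show ?thesis by (simp add: g_def power2_norm_eq_inner inner_add_right)
  qed
  ultimately have g: "g \<le> \<alpha> * \<kappa> * (norm c)\<^sup>2"
  proof (cases "g \<le> 0")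
    case False
    assume a: "g \<le> norm v * (\<kappa> * norm c)" "(norm v)\<^sup>2 \<le> \<alpha> * g"
    have "g\<^sup>2 \<le> (norm v * (\<kappa> * norm c))\<^sup>2"
      using a(1) False by (intro power_mono) auto
    also have "\<dots> = (norm v)\<^sup>2 * (\<kappa> * norm c)\<^sup>2"
      by (simp add: power_mult_distrib)
    also have "\<dots> \<le> (\<alpha> * g) * (\<kappa> * norm c)\<^sup>2"
      using a(2) by (intro mult_right_mono) auto
    finally have "g \<le> \<alpha> * (\<kappa> * norm c)\<^sup>2"
      using False by (simp add: power2_eq_square)
    also have "\<dots> = \<alpha> * \<kappa>\<^sup>2 * (norm c)\<^sup>2"
      by (simp add: power_mult_distrib)
    \<comment> \<open>The elimination yields \<kappa>^2; as \<kappa> lies in [0, 1], this is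
      weakened to \<kappa>.\<close>
    also have "\<dots> \<le> \<alpha> * \<kappa> * (norm c)\<^sup>2"
      using \<alpha> \<kappa> by (intro mult_right_mono mult_left_mono)
        (auto simp: power2_eq_square mult_left_le)
    finally show ?thesis .
  next
    case True
    then show ?thesis using \<alpha> \<kappa> by (smt (verit) mult_nonneg_nonneg zero_le_power2)
  qed
  have "c \<bullet> x - c \<bullet> z = \<alpha> * (norm c)\<^sup>2 - g"
    by (simp add: g_def v_def power2_norm_eq_inner inner_diff_left inner_diff_right inner_commute)
  with g show ?thesis by (simp add: algebra_simps)
qed

section \<open>The iterates: feasibility, fixed points and termination\<close>

lemma iterate_feasible:
  assumes "lp_solutions A b c \<noteq> {}" "projection_iteration A b c \<alpha> x"
    "\<sigma> = 0 \<longrightarrow> x 0 \<in> feasible A b"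
  shows "x \<sigma> \<in> feasible A b"
proof (cases \<sigma>)
  case (Suc k)
  have "feasible A b \<noteq> {}" using assms(1) by (auto simp: lp_solutions_def)
  then show ?thesis
    using assms(2) Suc by (auto simp: projection_iteration_def closest_point_in_set closed_feasible)
qed (use assms in auto)

text \<open>At a solution -c is normal, so a step along it projects back to the same point.\<close>

lemma iterate_remains_solution:
  assumes "projection_iteration A b c \<alpha> x" "x \<sigma> \<in> lp_solutions A b c" "\<sigma> \<le> \<tau>"
  shows "x \<tau> \<in> lp_solutions A b c"
  using assms(3)
proof (induction rule: dec_induct)
  case (step k)
  have "0 < \<alpha> k" and x: "x (Suc k) = closest_point (feasible A b) (x k + \<alpha> k *\<^sub>R (- c))"
    using assms(1) by (auto simp: projection_iteration_def)
  then have "x (Suc k) = x k"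
    using step.IH unfolding x
    by (intro closest_point_add_normal convex_feasible closed_feasible normal_cone_scaleR)
      (auto simp: lp_solutions_iff_normal)
  then show ?case using step.IH by simp
qed (rule assms(2))

text \<open>If the iterate at m + N lies outside X, then by \<open>stay\<close> so do all earlier
  ones, and the N decreases telescope to more than the available gap.\<close>

lemma finite_termination:
  assumes "\<And>\<sigma>. m \<le> \<sigma> \<Longrightarrow> x (Suc \<sigma>) \<notin> X \<Longrightarrow> K \<le> f (x \<sigma>) - f (x (Suc \<sigma>))" "0 < K"
    and stay: "\<And>\<sigma> \<tau>. x \<sigma> \<in> X \<Longrightarrow> \<sigma> \<le> \<tau> \<Longrightarrow> x \<tau> \<in> X"
    and lower: "\<And>\<sigma>. m \<le> \<sigma> \<Longrightarrow> fmin \<le> f (x \<sigma>)"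
    and N: "(f (x m) - fmin) / K < real N"
  shows "x (m + N) \<in> X"
proof (rule ccontr)
  assume notin: "x (m + N) \<notin> X"
  have "real j * K \<le> f (x m) - f (x (m + j))" if "j \<le> N" for j
    using that
  proof (induction j)
    case (Suc j)
    have "x (Suc (m + j)) \<notin> X"
      using notin stay[of "Suc (m + j)" "m + N"] Suc.prems by auto
    then have "K \<le> f (x (m + j)) - f (x (Suc (m + j)))"
      by (intro assms(1)) auto
    with Suc show ?case by (simp add: algebra_simps)
  qed simp
  from this[of N] have "real N * K \<le> f (x m) - fmin"
    using lower[of "m + N"] by simp
  then show False
    using N \<open>0 < K\<close> by (simp add: field_simps)
qed

text \<open>For y = x0 - \<alpha> c and t = \<alpha> the vector y - q + t c is x0 - q, independent
  of \<alpha>, so the linearly growing tolerance eventually exceeds its norm.\<close>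

lemma large_step_reaches_solution:
  assumes "lp_solutions A b c \<noteq> {}"
  obtains a where "\<And>\<alpha>. a \<le> \<alpha> \<Longrightarrow> closest_point (feasible A b) (x0 - \<alpha> *\<^sub>R c) \<in> lp_solutions A b c"
proof -
  obtain \<delta> where \<delta>: "0 < \<delta>"
    "\<And>q y t. q \<in> lp_solutions A b c \<Longrightarrow> 0 < t \<Longrightarrow> norm (y - q + t *\<^sub>R c) < \<delta> * t \<Longrightarrow>
      closest_point (feasible A b) y \<in> lp_solutions A b c"
    using projection_in_lp_solutions[OF assms] by metis
  obtain q where q: "q \<in> lp_solutions A b c" using assms by blast
  have "closest_point (feasible A b) (x0 - \<alpha> *\<^sub>R c) \<in> lp_solutions A b c"
    if \<alpha>: "norm (x0 - q) / \<delta> + 1 \<le> \<alpha>" for \<alpha>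
  proof (rule \<delta>(2)[OF q])
    have "0 \<le> norm (x0 - q) / \<delta>" using \<delta>(1) by simp
    then show "0 < \<alpha>" using \<alpha> by linarith
    have "norm (x0 - q) / \<delta> < \<alpha>" using \<alpha> by simp
    then show "norm (x0 - \<alpha> *\<^sub>R c - q + \<alpha> *\<^sub>R c) < \<delta> * \<alpha>"
      using \<delta>(1) by (simp add: field_simps)
  qed
  then show ?thesis using that by blast
qed

text \<open>With an empty frontier the cone is the whole space, so 0 is interior. But 0 is normal at
  every feasible point, and normals at non-optimal points are never interior.\<close>

lemma lp_solutions_eq_feasible_if_frontier_empty:
  assumes "lp_solutions A b c \<noteq> {}" "frontier (asymptotic_cone (solution_normals A b c)) = {}"
  shows "lp_solutions A b c = feasible A b"
proof -
  have "interior (asymptotic_cone (solution_normals A b c)) = UNIV"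
    using assms(2) uminus_cost_in_interior[OF assms(1)] frontier_eq_empty[of "asymptotic_cone (solution_normals A b c)"]
    by auto
  moreover have "0 \<in> normal_cone (feasible A b) z" for z
    by (simp add: normal_cone_def)
  ultimately show ?thesis
    using normal_at_nonsolution_notin_interior[of _ A b c 0] by (auto simp: lp_solutions_def)
qed

lemma minimal_angle:
  fixes c :: "real^'n"
  assumes sol: "lp_solutions A b c \<noteq> {}"
  defines "F \<equiv> frontier (asymptotic_cone (solution_normals A b c))"
  obtains \<theta> where "0 < \<theta>" "\<theta> \<le> pi / 2"
    "F \<noteq> {} \<Longrightarrow> \<theta> = arccos (norm (closest_point F (- c)) / norm c)"
    "\<And>x z \<alpha>. x \<in> feasible A b \<Longrightarrow> z = closest_point (feasible A b) (x - \<alpha> *\<^sub>R c) \<Longrightarrow>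
       z \<notin> lp_solutions A b c \<Longrightarrow> 0 < \<alpha> \<Longrightarrow> \<alpha> * (1 - cos \<theta>) * (norm c)\<^sup>2 \<le> c \<bullet> x - c \<bullet> z"
proof (cases "c = 0 \<or> F = {}")
  case True
  \<comment> \<open>In this degenerate case the decrease claim is vacuous. The angle pi / 2 also
    meets the formula for c = 0, since division by zero gives 0 and arccos 0 = pi / 2.\<close>
  then have "lp_solutions A b c = feasible A b"
    using lp_solutions_eq_feasible_if_frontier_empty[OF sol] by (auto simp: F_def lp_solutions_def)
  moreover have "closest_point (feasible A b) y \<in> feasible A b" if "x \<in> feasible A b" for x y
    using that by (intro closest_point_in_set closed_feasible) auto
  ultimately show ?thesis
    using True by (intro that[of "pi / 2"]) auto
next
  case False
  define D where "D = asymptotic_cone (solution_normals A b c)"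
  define p where "p = closest_point F (- c)"
  define \<kappa> where "\<kappa> = norm p / norm c"
  have F: "closed F" "F \<noteq> {}" using False by (auto simp: F_def)
  have p: "p \<in> frontier D" "\<And>x. x \<in> frontier D \<Longrightarrow> dist (- c) p \<le> dist (- c) x"
    using closest_point_in_set[OF F] closest_point_le[OF F(1)] by (auto simp: F_def D_def p_def)
  note bounds = inner_le_of_notin_interior_cone[OF
      asymptotic_cone_scaleR_image[of _ "solution_normals A b c", folded D_def]
      uminus_cost_in_interior[OF sol, folded D_def] p]
  \<comment> \<open>\<open>bounds(1)\<close> still carries the premise on v, for which p itself
    serves.\<close>
  have "p \<notin> interior D" using p(1) by (simp add: frontier_def)
  then have \<kappa>: "0 \<le> \<kappa>" "\<kappa> < 1"
    using bounds(1) False by (auto simp: \<kappa>_def)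
  show ?thesis
  proof (rule that[of "arccos \<kappa>"])
    show "0 < arccos \<kappa>" using \<kappa> arccos_less_arccos[of \<kappa> 1] by simp
    show "arccos \<kappa> \<le> pi / 2" using \<kappa> by (intro arccos_le_pi2) auto
    show "arccos \<kappa> = arccos (norm (closest_point F (- c)) / norm c)"
      by (simp add: \<kappa>_def p_def)
    fix x z \<alpha>
    assume "x \<in> feasible A b" "z = closest_point (feasible A b) (x - \<alpha> *\<^sub>R c)"
      "z \<notin> lp_solutions A b c" "0 < \<alpha>"
    then have "\<alpha> * (1 - \<kappa>) * (norm c)\<^sup>2 \<le> c \<bullet> x - c \<bullet> z"
      using False \<kappa> bounds(2)
      by (intro projection_step_decrease) (auto simp: \<kappa>_def D_def)
    then show "\<alpha> * (1 - cos (arccos \<kappa>)) * (norm c)\<^sup>2 \<le> c \<bullet> x - c \<bullet> z"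
      using \<kappa> by simp
  qed
qed

lemma iterate_solution_at_bound:
  fixes p :: int
  assumes sol: "lp_solutions A b c \<noteq> {}" and it: "projection_iteration A b c \<alpha> x"
    and \<theta>: "0 < \<theta>" "\<theta> \<le> pi / 2"
    and dec: "\<And>\<sigma>. (\<sigma> = 0 \<longrightarrow> x 0 \<in> feasible A b) \<Longrightarrow> x (Suc \<sigma>) \<notin> lp_solutions A b c \<Longrightarrow>
      \<alpha> \<sigma> * (1 - cos \<theta>) * (norm c)\<^sup>2 \<le> c \<bullet> x \<sigma> - c \<bullet> x (Suc \<sigma>)"
    and xs: "xs \<in> lp_solutions A b c" and a: "0 < a"
    and p: "-1 \<le> p" "p = -1 \<Longrightarrow> x 0 \<in> feasible A b"
    and steps: "\<And>\<sigma>. p \<le> int \<sigma> \<Longrightarrow> a \<le> \<alpha> \<sigma>"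
  shows "x (nat \<lfloor>(c \<bullet> x (nat (p + 1)) - c \<bullet> xs) / (a * (1 - cos \<theta>) * (norm c)\<^sup>2)
      + real_of_int p + 2\<rfloor>) \<in> lp_solutions A b c"
proof -
  \<comment> \<open>Decreases are counted from m = p + 1 on. N = floor R + 1 is the least integer
    above R, so the index floor R + p + 2 is m + N.\<close>
  define m where "m = nat (p + 1)"
  define K where "K = a * (1 - cos \<theta>) * (norm c)\<^sup>2"
  define R where "R = (c \<bullet> x m - c \<bullet> xs) / K"
  define N where "N = nat (\<lfloor>R\<rfloor> + 1)"
  have pm: "p = int m - 1" using p(1) by (simp add: m_def)
  have feas: "x \<sigma> \<in> feasible A b" if "m \<le> \<sigma>" for \<sigma>
    using that p(2) pm by (intro iterate_feasible[OF sol it]) auto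
  have lower: "c \<bullet> xs \<le> c \<bullet> x \<sigma>" if "m \<le> \<sigma>" for \<sigma>
    using xs feas[OF that] by (simp add: lp_solutions_def)
  have "cos \<theta> < cos 0"
    using \<theta> by (intro cos_monotone_0_pi) auto
  then have cos: "0 < 1 - cos \<theta>" by simp
  then have "0 \<le> K" using a by (simp add: K_def)
  then have R: "0 \<le> R" using lower[of m] by (simp add: R_def)
  have "x (m + N) \<in> lp_solutions A b c"
  proof (cases "c = 0")
    case True
    then show ?thesis using feas[of "m + N"] by (simp add: lp_solutions_def)
  next
    case False
    show ?thesis
    proof (rule finite_termination[where K = K and f = "\<lambda>y. c \<bullet> y" and fmin = "c \<bullet> xs"])
      show "0 < K" using False a cos by (simp add: K_def)
      show "K \<le> c \<bullet> x \<sigma> - c \<bullet> x (Suc \<sigma>)"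
        if "m \<le> \<sigma>" "x (Suc \<sigma>) \<notin> lp_solutions A b c" for \<sigma>
      proof -
        have "K \<le> \<alpha> \<sigma> * (1 - cos \<theta>) * (norm c)\<^sup>2"
          unfolding K_def using steps[of \<sigma>] that(1) pm cos by (intro mult_right_mono) auto
        also have "\<dots> \<le> c \<bullet> x \<sigma> - c \<bullet> x (Suc \<sigma>)"
          using that p(2) pm by (intro dec) auto
        finally show ?thesis .
      qed
      show "(c \<bullet> x m - c \<bullet> xs) / K < real N"
        using R unfolding N_def R_def[symmetric] by linarith
    qed (use lower iterate_remains_solution[OF it] in auto)
  qed
  \<comment> \<open>As R \<ge> 0 and p \<ge> -1, \<open>nat\<close> truncates nothing here.\<close>
  moreover have "nat \<lfloor>R + real_of_int p + 2\<rfloor> = m + N"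
    using R pm unfolding N_def by linarith
  ultimately show ?thesis
    unfolding R_def K_def m_def by simp
qed

text \<open>An infeasible start may have an objective value below the optimum, so the decrease at
  index 0 and the count for p = -1 ask for feasibility of \<open>x 0\<close>; later iterates are
  projections. The angle formula is guarded because \<open>closest_point\<close> is unspecified on
  an empty frontier. \<open>nat\<close> of the floor renders the nonnegative integer part.\<close>

theorem theorem2:
  fixes A :: "real^'n^'m" and b :: "real^'m" and c :: "real^'n"
  assumes "lp_solutions A b c \<noteq> {}"
  shows "(\<forall>x0. \<exists>\<alpha>bar. \<forall>\<alpha> x. projection_iteration A b c \<alpha> x \<and> x 0 = x0 \<and> \<alpha> 0 \<ge> \<alpha>bar
             \<longrightarrow> x 1 \<in> lp_solutions A b c)
       \<and> (\<exists>\<theta>min. 0 < \<theta>min \<and> \<theta>min \<le> pi / 2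
           \<and> (frontier (asymptotic_cone (solution_normals A b c)) \<noteq> {} \<longrightarrow>
                \<theta>min = arccos (norm (closest_point
                   (frontier (asymptotic_cone (solution_normals A b c))) (- c)) / norm c))
           \<and> (\<forall>\<alpha> x. projection_iteration A b c \<alpha> x \<longrightarrow>
                (\<forall>\<sigma>. (\<sigma> = 0 \<longrightarrow> x 0 \<in> feasible A b) \<and> x (Suc \<sigma>) \<notin> lp_solutions A b c \<longrightarrow>
                   c \<bullet> x \<sigma> - c \<bullet> x (Suc \<sigma>) \<ge> \<alpha> \<sigma> * (1 - cos \<theta>min) * (norm c)\<^sup>2)
              \<and> (\<forall>xstar \<in> lp_solutions A b c. \<forall>a > 0. \<forall>p::int.
                   (p = -1 \<or> p \<ge> 1) \<and> (p = -1 \<longrightarrow> x 0 \<in> feasible A b)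
                   \<and> (\<forall>\<sigma>. p \<le> int \<sigma> \<longrightarrow> \<alpha> \<sigma> \<ge> a) \<longrightarrow>
                   x (nat \<lfloor>(c \<bullet> x (nat (p + 1)) - c \<bullet> xstar) / (a * (1 - cos \<theta>min) * (norm c)\<^sup>2)
                            + real_of_int p + 2\<rfloor>) \<in> lp_solutions A b c)))"
proof (intro conjI)
  show "\<forall>x0. \<exists>\<alpha>bar. \<forall>\<alpha> x. projection_iteration A b c \<alpha> x \<and> x 0 = x0 \<and> \<alpha> 0 \<ge> \<alpha>bar
      \<longrightarrow> x 1 \<in> lp_solutions A b c"
  proof
    fix x0
    obtain a where "\<And>\<alpha>. a \<le> \<alpha> \<Longrightarrow>
        closest_point (feasible A b) (x0 - \<alpha> *\<^sub>R c) \<in> lp_solutions A b c"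
      using large_step_reaches_solution[OF assms] by metis
    then show "\<exists>\<alpha>bar. \<forall>\<alpha> x. projection_iteration A b c \<alpha> x \<and> x 0 = x0 \<and> \<alpha> 0 \<ge> \<alpha>bar
        \<longrightarrow> x 1 \<in> lp_solutions A b c"
      by (metis One_nat_def projection_iteration_def)
  qed
next
  obtain \<theta> where \<theta>: "0 < \<theta>" "\<theta> \<le> pi / 2"
    "frontier (asymptotic_cone (solution_normals A b c)) \<noteq> {} \<Longrightarrow>
      \<theta> = arccos (norm (closest_point
        (frontier (asymptotic_cone (solution_normals A b c))) (- c)) / norm c)"
    "\<And>x z \<alpha>. x \<in> feasible A b \<Longrightarrow> z = closest_point (feasible A b) (x - \<alpha> *\<^sub>R c) \<Longrightarrow>
       z \<notin> lp_solutions A b c \<Longrightarrow> 0 < \<alpha> \<Longrightarrow> \<alpha> * (1 - cos \<theta>) * (norm c)\<^sup>2 \<le> c \<bullet> x - c \<bullet> z"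
    using minimal_angle[OF assms] by metis
  have dec: "\<alpha> \<sigma> * (1 - cos \<theta>) * (norm c)\<^sup>2 \<le> c \<bullet> x \<sigma> - c \<bullet> x (Suc \<sigma>)"
    if "projection_iteration A b c \<alpha> x" "\<sigma> = 0 \<longrightarrow> x 0 \<in> feasible A b"
      "x (Suc \<sigma>) \<notin> lp_solutions A b c" for \<alpha> x \<sigma>
    using that iterate_feasible[OF assms that(1,2)]
    by (intro \<theta>(4)) (auto simp: projection_iteration_def)
  show "\<exists>\<theta>min. 0 < \<theta>min \<and> \<theta>min \<le> pi / 2
           \<and> (frontier (asymptotic_cone (solution_normals A b c)) \<noteq> {} \<longrightarrow>
                \<theta>min = arccos (norm (closest_point
                   (frontier (asymptotic_cone (solution_normals A b c))) (- c)) / norm c))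
           \<and> (\<forall>\<alpha> x. projection_iteration A b c \<alpha> x \<longrightarrow>
                (\<forall>\<sigma>. (\<sigma> = 0 \<longrightarrow> x 0 \<in> feasible A b) \<and> x (Suc \<sigma>) \<notin> lp_solutions A b c \<longrightarrow>
                   c \<bullet> x \<sigma> - c \<bullet> x (Suc \<sigma>) \<ge> \<alpha> \<sigma> * (1 - cos \<theta>min) * (norm c)\<^sup>2)
              \<and> (\<forall>xstar \<in> lp_solutions A b c. \<forall>a > 0. \<forall>p::int.
                   (p = -1 \<or> p \<ge> 1) \<and> (p = -1 \<longrightarrow> x 0 \<in> feasible A b)
                   \<and> (\<forall>\<sigma>. p \<le> int \<sigma> \<longrightarrow> \<alpha> \<sigma> \<ge> a) \<longrightarrow>
                   x (nat \<lfloor>(c \<bullet> x (nat (p + 1)) - c \<bullet> xstar) / (a * (1 - cos \<theta>min) * (norm c)\<^sup>2)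
                            + real_of_int p + 2\<rfloor>) \<in> lp_solutions A b c))"
  proof (intro exI[of _ \<theta>] conjI allI impI ballI)
    fix \<alpha> x \<sigma>
    assume "projection_iteration A b c \<alpha> x"
      "(\<sigma> = 0 \<longrightarrow> x 0 \<in> feasible A b) \<and> x (Suc \<sigma>) \<notin> lp_solutions A b c"
    then show "c \<bullet> x \<sigma> - c \<bullet> x (Suc \<sigma>) \<ge> \<alpha> \<sigma> * (1 - cos \<theta>) * (norm c)\<^sup>2"
      by (intro dec) auto
  next
    fix \<alpha> x xstar and a :: real and p :: int
    assume it: "projection_iteration A b c \<alpha> x" and "xstar \<in> lp_solutions A b c" "0 < a"
      "(p = -1 \<or> p \<ge> 1) \<and> (p = -1 \<longrightarrow> x 0 \<in> feasible A b) \<and> (\<forall>\<sigma>. p \<le> int \<sigma> \<longrightarrow> \<alpha> \<sigma> \<ge> a)"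
    then show "x (nat \<lfloor>(c \<bullet> x (nat (p + 1)) - c \<bullet> xstar) / (a * (1 - cos \<theta>) * (norm c)\<^sup>2)
        + real_of_int p + 2\<rfloor>) \<in> lp_solutions A b c"
      by (intro iterate_solution_at_bound[OF assms it \<theta>(1,2) dec[OF it]]) auto
  qed (use \<theta>(1-3) in simp_all)
qed

end
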